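(* Let $p$ be an odd prime and $\alpha,z\in\mathbb Z_p$. If $\langle-\alpha\rangle_p$ is even and $z-1$ is prime to $p$, then $$ {}_2F_1\bigg[\begin{matrix}\alpha&\frac12\\&1\end{matrix}\bigg|\,z\bigg]_{p-1}+(1-z)^{\langle-\alpha\rangle_p}{}_2F_1\bigg[\begin{matrix}\alpha&\frac12\\&1\end{matrix}\bigg|\,\frac{z}{z-1}\bigg]_{p-1}\equiv2(1-z)^{\frac12\langle-\alpha\rangle_p}{}_2F_1\bigg[\begin{matrix}\frac12\alpha&\frac12-\frac12\alpha\\&1\end{matrix}\bigg|\,\frac{z^2}{4z-4}\bigg]_{p-1}\pmod{p^2}. $$
   Context: $\mathbb Z_p$ denotes the $p$-adic integers. For $\alpha\in\mathbb Z_p$, $\langle\alpha\rangle_p$ is the unique integer in $\{0,1,\ldots,p-1\}$ congruent to $\alpha$ modulo $p$. Pochhammer symbol: $(x)_0=1$, $(x)_k=x(x+1)\cdots(x+k-1)$. For $n\ge 0$, ${}_{2}F_1\Big[\begin{matrix}\alpha&\beta\\&\gamma\end{matrix}\Big|\,z\Big]_n=\sum_{k=0}^{n}\frac{(\alpha)_k(\beta)_k}{(\gamma)_k}\cdot\frac{z^k}{k!}$. For $x,y\in\mathbb Q_p$, $x\equiv y\pmod{p^2}$ means $x-y\in p^2\mathbb Z_p$. *)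

theory Defs
  imports
    "HOL-Computational_Algebra.Computational_Algebra"
    "Berlekamp_Zassenhaus.Finite_Field"
begin

section \<open>The \<open>p\<close>-adic integers\<close>

text \<open>
  The prime \<open>p\<close> is the cardinality \<open>CARD('p)\<close> of a type parameter \<open>'p\<close> of class
  \<open>prime_card\<close>, so that \<open>'p padic_int\<close> and \<open>'p padic\<close> are the types of \<open>p\<close>-adic integers
  and \<open>p\<close>-adic numbers.  The \<open>p\<close>-adic integers are the inverse limit of the
  \<open>\<int>/p\<^sup>n\<int>\<close>: the \<open>n\<close>-th component of a sequence is the reduced residue modulo \<open>p\<^sup>n\<close>.
\<close>

typedef 'p padic_int =
  "{x :: nat \<Rightarrow> int. \<forall>n. x n \<in> {0..<int CARD('p::prime_card) ^ n} \<and>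
                         x (Suc n) mod int CARD('p) ^ n = x n}"
  morphisms padic_digits Abs_padic_int
  by (rule exI[of _ "\<lambda>_. 0"]) (auto simp: prime_card prime_gt_0_nat)

setup_lifting type_definition_padic_int

lemma padic_reduce_coherent:
  fixes f :: "nat \<Rightarrow> int"
  assumes "\<And>n. [f (Suc n) = f n] (mod int CARD('p::prime_card) ^ n)"
  shows "(f n mod int CARD('p) ^ n) \<in> {0..<int CARD('p) ^ n} \<and>
         (f (Suc n) mod int CARD('p) ^ Suc n) mod int CARD('p) ^ n = f n mod int CARD('p) ^ n"
proof -
  have "CARD('p) > 0" using prime_card prime_gt_0_nat by blast
  moreover have "(f (Suc n) mod int CARD('p) ^ Suc n) mod int CARD('p) ^ n = f (Suc n) mod int CARD('p) ^ n"
    by (rule mod_mod_cancel) simp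
  ultimately show ?thesis using assms[of n] by (simp add: cong_def)
qed

lemma padic_coherent_cong:
  assumes "\<forall>n. x n \<in> {0..<q ^ n} \<and> x (Suc n) mod q ^ n = (x n :: int)"
  shows "[x (Suc n) = x n] (mod q ^ n)"
  using assms by (metis cong_def mod_mod_trivial)

instantiation padic_int :: (prime_card) comm_ring_1
begin

lift_definition zero_padic_int :: "'a padic_int" is "\<lambda>_. 0"
  by (auto simp: prime_card prime_gt_0_nat)

lift_definition one_padic_int :: "'a padic_int" is "\<lambda>n. 1 mod int CARD('a) ^ n"
  by (rule padic_reduce_coherent) simp

lift_definition plus_padic_int :: "'a padic_int \<Rightarrow> 'a padic_int \<Rightarrow> 'a padic_int"
  is "\<lambda>x y n. (x n + y n) mod int CARD('a) ^ n"
  by (intro padic_reduce_coherent cong_add padic_coherent_cong) blast+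

lift_definition minus_padic_int :: "'a padic_int \<Rightarrow> 'a padic_int \<Rightarrow> 'a padic_int"
  is "\<lambda>x y n. (x n - y n) mod int CARD('a) ^ n"
  by (intro padic_reduce_coherent cong_diff padic_coherent_cong) blast+

lift_definition uminus_padic_int :: "'a padic_int \<Rightarrow> 'a padic_int"
  is "\<lambda>x n. (- x n) mod int CARD('a) ^ n"
  by (intro padic_reduce_coherent cong_minus_minus_iff[THEN iffD2] padic_coherent_cong) blast+

lift_definition times_padic_int :: "'a padic_int \<Rightarrow> 'a padic_int \<Rightarrow> 'a padic_int"
  is "\<lambda>x y n. (x n * y n) mod int CARD('a) ^ n"
  by (intro padic_reduce_coherent cong_mult padic_coherent_cong) blast+

instance
proof
  have gt1: "int CARD('a) > 1" by (rule prime_gt_1_int[OF prime_card_int])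
  fix a b c :: "'a padic_int"
  show "a * b * c = a * (b * c)" by transfer (simp add: mod_simps ac_simps)
  show "a * b = b * a" by transfer (simp add: ac_simps)
  show "1 * a = a" by transfer (auto simp: mod_simps)
  show "a + b + c = a + (b + c)" by transfer (simp add: mod_simps ac_simps)
  show "a + b = b + a" by transfer (simp add: ac_simps)
  show "0 + a = a" by transfer auto
  show "- a + a = 0" by transfer (simp add: mod_simps)
  show "a - b = a + - b" by transfer (simp add: mod_simps)
  show "(a + b) * c = a * c + b * c" by transfer (simp add: mod_simps algebra_simps)
  show "(0::'a padic_int) \<noteq> 1"
  proof
    assume "(0::'a padic_int) = 1"
    then have "padic_digits (0::'a padic_int) 1 = padic_digits 1 1" by simp
    then show False using gt1 by (simp add: zero_padic_int.rep_eq one_padic_int.rep_eq)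
  qed
qed

end

lemma padic_digits_mod:
  "m \<le> n \<Longrightarrow> padic_digits (x :: 'p::prime_card padic_int) n mod int CARD('p) ^ m = padic_digits x m"
proof (induction n rule: dec_induct)
  case base
  then show ?case using padic_digits[of x] by auto
next
  case (step n)
  have "padic_digits x (Suc n) mod int CARD('p) ^ n = padic_digits x n"
    using padic_digits[of x] by auto
  moreover have "int CARD('p) ^ m dvd int CARD('p) ^ n" using step by (simp add: le_imp_power_dvd)
  ultimately show ?case using step.IH by (metis mod_mod_cancel)
qed

instance padic_int :: (prime_card) idom
proof
  fix a b :: "'a padic_int"
  let ?p = "int CARD('a)"
  assume "a \<noteq> 0" "b \<noteq> 0"
  then obtain m k where mk: "padic_digits a m \<noteq> 0" "padic_digits b k \<noteq> 0"
    by (auto simp: padic_digits_inject[symmetric] zero_padic_int.rep_eq fun_eq_iff)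
  define A B where "A = padic_digits a (m + k)" and "B = padic_digits b (m + k)"
  have nd: "\<not> ?p ^ m dvd A" "\<not> ?p ^ k dvd B"
    using mk padic_digits_mod[of m "m + k" a] padic_digits_mod[of k "m + k" b]
    unfolding A_def B_def dvd_eq_mod_eq_0 by simp_all
  have pr: "prime ?p" by (rule prime_card_int)
  have nz: "A \<noteq> 0" "B \<noteq> 0" using nd by auto
  have nu: "\<not> is_unit ?p" using pr by auto
  have "multiplicity ?p A < m" "multiplicity ?p B < k"
    using nd nz nu by (simp_all add: power_dvd_iff_le_multiplicity)
  then have "multiplicity ?p (A * B) < m + k"
    using nz pr by (simp add: prime_elem_multiplicity_mult_distrib)
  then have "\<not> ?p ^ (m + k) dvd A * B"
    using nz nu by (simp add: power_dvd_iff_le_multiplicity)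
  then have "padic_digits (a * b) (m + k) \<noteq> 0"
    by (simp add: times_padic_int.rep_eq A_def B_def dvd_eq_mod_eq_0)
  then show "a * b \<noteq> 0" by (auto simp: zero_padic_int.rep_eq)
qed

lemma padic_digits_of_nat:
  "padic_digits (of_nat k :: 'p::prime_card padic_int) n = int k mod int CARD('p) ^ n"
  by (induction k) (simp_all add: zero_padic_int.rep_eq one_padic_int.rep_eq
      plus_padic_int.rep_eq mod_simps)

instance padic_int :: (prime_card) ring_char_0
proof (intro_classes, rule injI)
  fix k l :: nat
  assume eq: "(of_nat k :: 'a padic_int) = of_nat l"
  define n where "n = k + l"
  have "CARD('a) > 1" using prime_card prime_gt_1_nat by blast
  then have "n < CARD('a) ^ n" by (simp add: power_gt_expt)
  then have "int k < int CARD('a) ^ n" "int l < int CARD('a) ^ n"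
    by (simp_all add: n_def flip: of_nat_power)
  moreover have "int k mod int CARD('a) ^ n = int l mod int CARD('a) ^ n"
    using eq by (metis padic_digits_of_nat)
  ultimately show "k = l" by simp
qed


section \<open>The \<open>p\<close>-adic numbers\<close>

instance fract :: ("{idom, ring_char_0}") field_char_0
  by (intro_classes, rule injI) (simp add: of_nat_fract eq_fract)

type_synonym 'p padic = "'p padic_int fract"

definition Zp :: "'p::prime_card padic set" where
  "Zp = range to_fract"

text \<open>Congruence modulo \<open>p\<^sup>n\<int>\<^sub>p\<close> of elements of \<open>\<rat>\<^sub>p\<close>, which need not be \<open>p\<close>-adic integers.\<close>

definition padic_cong :: "nat \<Rightarrow> 'p::prime_card padic \<Rightarrow> 'p padic \<Rightarrow> bool" where
  "padic_cong n x y \<longleftrightarrow> (\<exists>w\<in>Zp. x - y = of_nat CARD('p) ^ n * w)"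

text \<open>As \<open>p\<close> is a prime element of \<open>\<int>\<^sub>p\<close>, being prime to \<open>p\<close> means not lying in \<open>p\<int>\<^sub>p\<close>.\<close>

definition prime_to_p :: "'p::prime_card padic \<Rightarrow> bool" where
  "prime_to_p x \<longleftrightarrow> x \<in> Zp \<and> \<not> (\<exists>w\<in>Zp. x = of_nat CARD('p) * w)"

text \<open>The least nonnegative residue \<open>\<langle>x\<rangle>\<^sub>p\<close>, meaningful for \<open>x \<in> Zp\<close>; see \<open>padic_residue_ex1\<close> below.\<close>

definition padic_residue :: "'p::prime_card padic \<Rightarrow> nat" where
  "padic_residue x = (THE r. r < CARD('p) \<and> padic_cong 1 x (of_nat r))"

lemma padic_int_dvd_iff:
  fixes w :: "'p::prime_card padic_int"
  shows "of_nat CARD('p) dvd w \<longleftrightarrow> padic_digits w 1 = 0"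
proof
  assume "of_nat CARD('p) dvd w"
  then show "padic_digits w 1 = 0"
    by (auto simp: times_padic_int.rep_eq padic_digits_of_nat)
next
  let ?p = "int CARD('p)"
  assume w1: "padic_digits w 1 = 0"
  have p0: "?p > 0" using prime_card prime_gt_0_nat by fastforce
  define f where "f = (\<lambda>n. padic_digits w (Suc n) div ?p)"
  have f: "?p * f n = padic_digits w (Suc n)" for n
    using padic_digits_mod[of 1 "Suc n" w] w1 by (auto simp: f_def)
  have "f n \<in> {0..<?p ^ n} \<and> f (Suc n) mod ?p ^ n = f n" for n
  proof -
    have "padic_digits w (Suc n) \<in> {0..<?p ^ Suc n}"
      using padic_digits[of w] by blast
    then have "0 \<le> ?p * f n" "?p * f n < ?p * ?p ^ n" by (simp_all add: f)
    then have "f n \<in> {0..<?p ^ n}" using p0 by (simp add: zero_le_mult_iff)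
    moreover have "(?p * f (Suc n)) mod (?p * ?p ^ n) = ?p * f n"
      using padic_digits_mod[of "Suc n" "Suc (Suc n)" w] by (simp add: f)
    then have "f (Suc n) mod ?p ^ n = f n"
      using p0 by (simp add: mult_mod_right[symmetric])
    ultimately show ?thesis by blast
  qed
  then have v: "padic_digits (Abs_padic_int f :: 'p padic_int) = f"
    by (intro Abs_padic_int_inverse) blast
  have "padic_digits (of_nat CARD('p) * (Abs_padic_int f :: 'p padic_int)) n = padic_digits w n" for n
    using padic_digits_mod[of n "Suc n" w]
    by (simp add: times_padic_int.rep_eq v padic_digits_of_nat mod_simps f)
  then have "w = of_nat CARD('p) * Abs_padic_int f"
    by (subst padic_digits_inject[symmetric]) auto
  then show "of_nat CARD('p) dvd w" by simp
qed

lemma padic_residue_ex1: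
  fixes x :: "'p::prime_card padic"
  assumes "x \<in> Zp"
  shows "\<exists>!r. r < CARD('p) \<and> padic_cong 1 x (of_nat r)"
proof -
  let ?p = "int CARD('p)"
  from assms obtain w where w: "x = Fract w 1" by (auto simp: Zp_def to_fract_def)
  have "padic_cong 1 x (of_nat r) \<longleftrightarrow> padic_digits w 1 = int r" if "r < CARD('p)" for r
  proof -
    have "padic_cong 1 x (of_nat r) \<longleftrightarrow> of_nat CARD('p) dvd w - of_nat r"
      by (auto simp: padic_cong_def Zp_def to_fract_def w of_nat_fract eq_fract dvd_def)
    also have "\<dots> \<longleftrightarrow> (padic_digits w 1 - int r) mod ?p = 0"
      by (simp add: padic_int_dvd_iff minus_padic_int.rep_eq padic_digits_of_nat mod_simps)
    also have "\<dots> \<longleftrightarrow> padic_digits w 1 mod ?p = int r mod ?p"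
      by (simp add: mod_eq_dvd_iff dvd_eq_mod_eq_0)
    also have "\<dots> \<longleftrightarrow> padic_digits w 1 = int r"
      using padic_digits_mod[of 1 1 w] that by simp
    finally show ?thesis .
  qed
  moreover have "padic_digits w 1 \<in> {0..<?p ^ 1}" using padic_digits[of w] by blast
  then have "int (nat (padic_digits w 1)) = padic_digits w 1" "nat (padic_digits w 1) < CARD('p)"
    by auto
  ultimately show ?thesis by (metis of_nat_eq_iff)
qed


section \<open>Truncated hypergeometric series\<close>

text \<open>The last argument \<open>n\<close> is the index of the final summand, so there are \<open>n + 1\<close> terms.\<close>

definition hyp2F1_trunc :: "'a::field_char_0 \<Rightarrow> 'a \<Rightarrow> 'a \<Rightarrow> 'a \<Rightarrow> nat \<Rightarrow> 'a" where
  "hyp2F1_trunc a b c z n =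
     (\<Sum>k=0..n. pochhammer a k * pochhammer b k / pochhammer c k * (z ^ k / fact k))"

end

(*
  Write a for the residue of -alpha, m = a/2 and e = (alpha + a)/2, a multiple of p, and let A(z) be
  the full power series 2F1(alpha, 1/2; 1; z). Over Q_p[[z]] the Pfaff and the quadratic
  transformation turn the difference of the two sides of the theorem, without truncation, into
    A + (1-z)^(2e) A - 2 (1-z)^e A = (1 - (1-z)^e)^2 A.
  Below degree p the coefficients of 1 - (1-z)^e are divisible by p and those of A are integral, so
  those of the product are divisible by p^2. Modulo p^2 the truncated series have small degree:
  past max(a, (p-1)/2), respectively max(m, (p-1)/2 - m), both Pochhammer symbols in the numerator
  are divisible by p. After multiplication by a power of 1-z the truncated difference is therefore
  a polynomial of degree less than p, and the formal computation determines all its coefficients.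
*)
theory Submission
  imports Defs
begin

section \<open>Ideals of the \<open>p\<close>-adic integers\<close>

text \<open>Exponent 0 gives \<open>Zp\<close> itself, so integrality and divisibility by powers of
  p share one family of closure rules.\<close>

definition padic_ideal :: "nat \<Rightarrow> 'p::prime_card padic set" where
  "padic_ideal r = (\<lambda>w. of_nat CARD('p) ^ r * w) ` Zp"

lemma padic_cong_iff: "padic_cong r x y \<longleftrightarrow> x - y \<in> padic_ideal r"
  by (auto simp: padic_cong_def padic_ideal_def)

lemma padic_ideal_0: "padic_ideal 0 = Zp"
  by (simp add: padic_ideal_def)

lemma Zp_add: "x \<in> Zp \<Longrightarrow> y \<in> Zp \<Longrightarrow> x + y \<in> Zp"
  by (auto simp: Zp_def simp flip: to_fract_add)

lemma Zp_mult: "x \<in> Zp \<Longrightarrow> y \<in> Zp \<Longrightarrow> x * y \<in> Zp"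
  by (auto simp: Zp_def simp flip: to_fract_mult)

lemma Zp_uminus: "x \<in> Zp \<Longrightarrow> - x \<in> Zp"
  by (auto simp: Zp_def simp flip: to_fract_uminus)

lemma Zp_0: "0 \<in> Zp"
  unfolding Zp_def by (metis rangeI to_fract_0)

lemma Zp_1: "1 \<in> Zp"
  unfolding Zp_def by (metis rangeI to_fract_1)

lemma Zp_of_nat: "of_nat k \<in> Zp"
  by (induction k) (auto intro: Zp_add Zp_0 Zp_1)

lemma Zp_power: "x \<in> Zp \<Longrightarrow> x ^ k \<in> Zp"
  by (induction k) (auto intro: Zp_mult Zp_1)

lemma padic_ideal_mult:
  "x \<in> padic_ideal r \<Longrightarrow> y \<in> padic_ideal s \<Longrightarrow> x * y \<in> padic_ideal (r + s)"
  by (force simp: padic_ideal_def power_add intro: Zp_mult)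

lemma padic_ideal_mult_right: "x \<in> padic_ideal r \<Longrightarrow> y \<in> Zp \<Longrightarrow> x * y \<in> padic_ideal r"
  using padic_ideal_mult[of x r y 0] by (simp add: padic_ideal_0)

lemma padic_ideal_mult_left: "y \<in> Zp \<Longrightarrow> x \<in> padic_ideal r \<Longrightarrow> y * x \<in> padic_ideal r"
  using padic_ideal_mult_right[of x r y] by (simp add: mult.commute)

lemma padic_ideal_add: "x \<in> padic_ideal r \<Longrightarrow> y \<in> padic_ideal r \<Longrightarrow> x + y \<in> padic_ideal r"
  by (auto simp: padic_ideal_def simp flip: distrib_left intro: Zp_add)

lemma padic_ideal_uminus: "x \<in> padic_ideal r \<Longrightarrow> - x \<in> padic_ideal r"
  by (auto simp: padic_ideal_def simp flip: mult_minus_right intro: Zp_uminus)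

lemma padic_ideal_diff: "x \<in> padic_ideal r \<Longrightarrow> y \<in> padic_ideal r \<Longrightarrow> x - y \<in> padic_ideal r"
  using padic_ideal_add[of x r "- y"] padic_ideal_uminus by auto

lemma Zp_diff: "x \<in> Zp \<Longrightarrow> y \<in> Zp \<Longrightarrow> x - y \<in> Zp"
  using padic_ideal_diff[of x 0 y] by (simp add: padic_ideal_0)

lemma padic_ideal_zero: "0 \<in> padic_ideal r"
  by (auto simp: padic_ideal_def intro!: image_eqI[of _ _ 0] Zp_0)

lemma padic_ideal_sum: "(\<And>i. i \<in> S \<Longrightarrow> f i \<in> padic_ideal r) \<Longrightarrow> sum f S \<in> padic_ideal r"
  by (induction S rule: infinite_finite_induct) (auto intro: padic_ideal_add padic_ideal_zero)

lemma of_nat_CARD_padic_ideal: "of_nat CARD('p) \<in> (padic_ideal 1 :: 'p::prime_card padic set)"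
  by (auto simp: padic_ideal_def intro!: image_eqI[of _ _ 1] Zp_1)

section \<open>Units of the p-adic integers and integrality of reciprocals\<close>

lemma to_fract_of_nat: "to_fract (of_nat k) = of_nat k"
  by (induction k) (simp_all only: of_nat_0 to_fract_0 of_nat_Suc to_fract_add to_fract_1)

text \<open>A nonzero residue modulo p makes every residue \<open>padic_digits w n\<close>
  invertible modulo p^n. Inverses modulo p^n are unique, so those at successive levels are
  compatible and define a p-adic integer.\<close>

lemma prime_to_p_imp_inverse_Zp:
  fixes x :: "'p::prime_card padic"
  assumes "prime_to_p x"
  shows "inverse x \<in> Zp"
proof -
  let ?p = "int CARD('p)"
  have pr: "prime ?p" by (rule prime_card_int)
  obtain w where w: "x = to_fract w" using assms by (auto simp: prime_to_p_def Zp_def)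
  have "\<not> of_nat CARD('p) dvd w"
    using assms unfolding prime_to_p_def Zp_def w
    by (metis dvdE rangeI to_fract_mult to_fract_of_nat)
  then have w1: "padic_digits w 1 \<noteq> 0" by (simp add: padic_int_dvd_iff)
  have cop: "coprime (padic_digits w n) (?p ^ n)" for n
  proof (cases "n = 0")
    case False
    then have "padic_digits w n mod ?p = padic_digits w 1"
      using padic_digits_mod[of 1 n w] by simp
    then have "\<not> ?p dvd padic_digits w n" using w1 by auto
    then show ?thesis
      using prime_imp_coprime[OF pr] by (simp add: coprime_commute)
  qed simp
  then have "\<forall>n. \<exists>v. [padic_digits w n * v = 1] (mod ?p ^ n)"
    using coprime_iff_invertible_int by blast
  then obtain v where v: "\<And>n. [padic_digits w n * v n = 1] (mod ?p ^ n)" by metis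
  have coh: "[v (Suc n) = v n] (mod ?p ^ n)" for n
  proof -
    have "[padic_digits w (Suc n) * v (Suc n) = 1] (mod ?p ^ n)"
      using v[of "Suc n"] by (rule cong_dvd_modulus) simp
    moreover have "[padic_digits w (Suc n) = padic_digits w n] (mod ?p ^ n)"
      using padic_digits_mod[of n "Suc n" w] padic_digits_mod[of n n w] by (simp add: cong_def)
    ultimately have "[padic_digits w n * v (Suc n) = padic_digits w n * v n] (mod ?p ^ n)"
      using v[of n] by (meson cong_scalar_right cong_sym cong_trans)
    then show ?thesis using cop by (simp add: cong_mult_lcancel)
  qed
  define y :: "'p padic_int" where "y = Abs_padic_int (\<lambda>n. v n mod ?p ^ n)"
  have y: "padic_digits y = (\<lambda>n. v n mod ?p ^ n)"
    unfolding y_def by (rule Abs_padic_int_inverse) (use padic_reduce_coherent[OF coh] in blast)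
  have "w * y = 1"
    using v by (subst padic_digits_inject[symmetric])
      (auto simp: times_padic_int.rep_eq one_padic_int.rep_eq y cong_def mod_simps fun_eq_iff)
  then have "x * to_fract y = 1" unfolding w by (metis to_fract_1 to_fract_mult)
  then have "inverse x = to_fract y" by (metis inverse_unique)
  then show ?thesis by (simp add: Zp_def)
qed

lemma inverse_of_nat_Zp:
  assumes "\<not> CARD('p::prime_card) dvd k"
  shows "inverse (of_nat k :: 'p padic) \<in> Zp"
proof (rule prime_to_p_imp_inverse_Zp)
  have "\<not> of_nat CARD('p) dvd (of_nat k :: 'p padic_int)"
    using assms by (simp add: padic_int_dvd_iff padic_digits_of_nat int_dvd_int_iff flip: dvd_eq_mod_eq_0)
  moreover have "of_nat CARD('p) dvd (of_nat k :: 'p padic_int)"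
    if eq: "(of_nat k :: 'p padic) = of_nat CARD('p) * w" and w: "w \<in> Zp" for w
  proof -
    obtain u where "w = to_fract u" using w by (auto simp: Zp_def)
    then have "to_fract (of_nat k) = to_fract (of_nat CARD('p) * u)"
      using eq by (metis to_fract_mult to_fract_of_nat)
    then show ?thesis by (metis dvd_triv_left to_fract_eq_iff)
  qed
  ultimately show "prime_to_p (of_nat k :: 'p padic)"
    by (auto simp: prime_to_p_def Zp_of_nat)
qed

lemma inverse_fact_Zp: "k < CARD('p::prime_card) \<Longrightarrow> inverse (fact k :: 'p padic) \<in> Zp"
proof (induction k)
  case (Suc k)
  have "\<not> CARD('p) dvd Suc k" using Suc.prems by (auto dest: dvd_imp_le)
  then show ?case
    using Suc inverse_of_nat_Zp[of "Suc k"] by (auto intro: Zp_mult simp del: of_nat_Suc)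
qed (simp add: Zp_1)

lemma pochhammer_Zp: "x \<in> Zp \<Longrightarrow> pochhammer x k \<in> Zp"
  by (induction k) (auto simp: pochhammer_Suc intro!: Zp_1 Zp_mult Zp_add Zp_of_nat)

text \<open>For k > j the product contains the factor \<open>x + of_nat j\<close>, and its other
  factors are integral.\<close>

lemma pochhammer_padic_ideal:
  assumes "x \<in> Zp" "x + of_nat j \<in> padic_ideal r" "j < k"
  shows "pochhammer x k \<in> padic_ideal r"
  using assms(3)
proof (induction k)
  case (Suc k)
  show ?case
  proof (cases "j = k")
    case True
    then show ?thesis
      using assms by (auto simp: pochhammer_Suc intro: padic_ideal_mult_left pochhammer_Zp)
  next
    case False
    then show ?thesis using Suc assms(1)
      by (auto simp: pochhammer_Suc intro!: padic_ideal_mult_right Zp_add Zp_of_nat)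
  qed
qed simp

section \<open>Two transformations at the level of coefficients\<close>

definition hyp_coeff :: "'a::field_char_0 \<Rightarrow> 'a \<Rightarrow> nat \<Rightarrow> 'a" where
  "hyp_coeff a b k = pochhammer a k * pochhammer b k / (fact k * fact k)"

lemma hyp2F1_trunc_1: "hyp2F1_trunc a b 1 z n = (\<Sum>k\<le>n. hyp_coeff a b k * z ^ k)"
  by (simp add: hyp2F1_trunc_def hyp_coeff_def pochhammer_fact atLeast0AtMost)

text \<open>The binomial series \<open>(1 - X) powr (-b)\<close>.\<close>

definition fps_pow :: "'a::field_char_0 \<Rightarrow> 'a fps" where
  "fps_pow b = Abs_fps (\<lambda>j. pochhammer b j / fact j)"

lemma fps_pow_nth: "fps_pow b $ j = pochhammer b j / fact j"
  by (simp add: fps_pow_def)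

text \<open>Comparing coefficients turns the law of exponents into Vandermonde's identity for rising
  factorials.\<close>

lemma fps_pow_add: "fps_pow (a + b) = fps_pow a * fps_pow b"
proof (rule fps_ext)
  fix n
  show "fps_pow (a + b) $ n = (fps_pow a * fps_pow b) $ n"
    by (simp add: fps_pow_nth fps_mult_nth pochhammer_binomial_sum sum_divide_distrib
        atLeast0AtMost binomial_fact field_simps)
qed

lemma fps_pow_0: "fps_pow 0 = 1"
  by (rule fps_ext) (auto simp: fps_pow_nth pochhammer_0_left)

lemma fps_pow_minus_1: "fps_pow (- 1) = 1 - fps_X"
proof (rule fps_ext)
  fix n
  consider "n = 0" | "n = 1" | k where "n = Suc (Suc k)" by (metis One_nat_def not0_implies_Suc)
  then show "fps_pow (- 1) $ n = ((1 :: 'a fps) - fps_X) $ n"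
    by cases (auto simp: fps_pow_nth pochhammer_rec)
qed

lemma fps_pow_minus_of_nat: "fps_pow (- of_nat n) = (1 - fps_X) ^ n"
proof (induction n)
  case (Suc n)
  have "- of_nat (Suc n) = - 1 + - (of_nat n :: 'a)" by simp
  then show ?case using Suc by (simp only: fps_pow_add fps_pow_minus_1 power_Suc)
qed (simp add: fps_pow_0)

section \<open>Pfaff's transformation\<close>

lemma fps_const_X_power_mult_nth:
  "(fps_const c * fps_X ^ k * F) $ N = (if N < k then 0 else c * F $ (N - k))"
  by (simp add: mult.assoc fps_X_power_mult_nth)

text \<open>Chu-Vandermonde with upper parameters 1/2 and -N and lower parameter 1. Its value
  involves 1 - 1/2 = 1/2, which is why Pfaff's transformation reproduces the parameters a, 1/2;
  1.\<close>

lemma hyp_coeff_half_sum: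
  "(\<Sum>k\<le>N. (- 1) ^ k * pochhammer (1/2) k / (fact k * fact k * fact (N - k)))
     = pochhammer (1/2) N / (fact N * fact N :: 'a::field_char_0)"
proof -
  have "(\<Sum>k=0..N. pochhammer (1/2) k * pochhammer (- of_nat N) k / (of_nat (fact k) * pochhammer 1 k))
      = pochhammer (1 - 1/2) N / (pochhammer 1 N :: 'a)"
  proof (rule Vandermonde_pochhammer, safe)
    fix i assume "(1 :: 'a) = - of_nat i"
    then have "of_nat (Suc i) = (0 :: 'a)" by (simp only: of_nat_Suc) (metis add.left_inverse)
    then show False by (simp only: of_nat_eq_0_iff)
  qed
  moreover have "pochhammer (- of_nat N) k = (- 1) ^ k * (fact N / fact (N - k) :: 'a)" if "k \<le> N" for k
  proof -
    have "pochhammer (- of_nat N) k = (- 1) ^ k * (fact k * of_nat (N choose k) :: 'a)"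
      unfolding binomial_gbinomial gbinomial_pochhammer by (simp add: mult_ac flip: power_mult_distrib)
    then show ?thesis using that by (simp add: binomial_fact)
  qed
  ultimately show ?thesis
    by (simp add: atLeast0AtMost pochhammer_fact[symmetric] field_simps sum_divide_distrib sum_distrib_left)
qed

text \<open>Coefficient form of 2F1(a, 1/2; 1; X) = (1 - X)^(-a) 2F1(a, 1/2; 1; X/(X - 1)). Terms
  with k > N start beyond degree N, so any L > N gives the full coefficient. Since (a)_k (a +
  k)_(N-k) = (a)_N, the parameter a factors out of the sum.\<close>

lemma pfaff_half_coeff:
  fixes a :: "'a::field_char_0"
  assumes "N < L"
  shows "(\<Sum>k<L. fps_const (hyp_coeff a (1/2) k * (- 1) ^ k) * fps_X ^ k * fps_pow (a + of_nat k)) $ N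
    = hyp_coeff a (1/2) N"
proof -
  have "(\<Sum>k<L. fps_const (hyp_coeff a (1/2) k * (- 1) ^ k) * fps_X ^ k * fps_pow (a + of_nat k)) $ N
      = (\<Sum>k\<le>N. hyp_coeff a (1/2) k * (- 1) ^ k * (pochhammer (a + of_nat k) (N - k) / fact (N - k)))"
    unfolding fps_sum_nth fps_const_X_power_mult_nth fps_pow_nth using assms
    by (intro sum.mono_neutral_cong_right) auto
  also have "\<dots> = (\<Sum>k\<le>N. pochhammer a N *
      ((- 1) ^ k * pochhammer (1/2) k / (fact k * fact k * fact (N - k))))"
    by (intro sum.cong) (auto simp: hyp_coeff_def pochhammer_product[of _ N a])
  also have "\<dots> = hyp_coeff a (1/2) N"
    by (simp only: hyp_coeff_half_sum hyp_coeff_def flip: sum_distrib_left) simp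
  finally show ?thesis .
qed

section \<open>The quadratic transformation\<close>

text \<open>The k-th contribution to the coefficient of X^N, with (b)_k (b + k)_(N-2k) merged into
  (b)_(N-k). The explicit zero guards against truncated subtraction in
  \<open>N - 2 * k\<close>.\<close>

definition quad_term :: "'a::field_char_0 \<Rightarrow> nat \<Rightarrow> nat \<Rightarrow> 'a" where
  "quad_term b N k = (if 2 * k \<le> N then
     pochhammer b (N - k) * pochhammer (1/2 - b) k * (- 1 / 4) ^ k / (fact k * fact k * fact (N - 2 * k))
     else 0)"

text \<open>
  Zeilberger's recurrence for the sum of \<open>quad_term b N k\<close> over \<open>k\<close>, with certificate
  \<open>G N k = -4 * k\<^sup>2 * quad_term b (N + 1) k\<close>.
\<close>

lemma quad_term_telescope:
  fixes b :: "'a::field_char_0"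
  shows "(of_nat N + 1)\<^sup>2 * quad_term b (Suc N) k - (2 * b + of_nat N) * (of_nat N + 1/2) * quad_term b N k
    = 4 * (of_nat k)\<^sup>2 * quad_term b (Suc N) k - 4 * (of_nat (Suc k))\<^sup>2 * quad_term b (Suc N) (Suc k)"
proof -
  \<comment> \<open>The cases follow the support of \<open>quad_term\<close>: in the first three at
    least one of the terms involved lies outside it, in the last one none does.\<close>
  consider "N + 1 < 2 * k" | "N + 1 = 2 * k" | "N = 2 * k" | i where "N = 2 * k + Suc i"
    by (metis Suc_eq_plus1 add_Suc_right less_iff_Suc_add linorder_neqE_nat not_less_eq)
  then show ?thesis
  proof cases
    case 1
    then show ?thesis by (simp add: quad_term_def)
  next
    case 2
    then have "of_nat N + 1 = (2 * of_nat k :: 'a)" by (metis of_nat_1 of_nat_add of_nat_mult of_nat_numeral)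
    with 2 show ?thesis by (simp add: quad_term_def power2_eq_square)
  next
    case 3
    have e: "quad_term b (Suc N) (Suc k) = 0" "N - k = k" "Suc N - k = Suc k"
      using 3 by (auto simp: quad_term_def)
    have "quad_term b (Suc N) k = (b + of_nat k) * quad_term b N k"
      using e 3 by (simp add: quad_term_def pochhammer_Suc)
    then show ?thesis using e 3 by (simp add: power2_eq_square algebra_simps)
  next
    case 4
    define c x where "c = (of_nat k :: 'a)" and "x = (of_nat i :: 'a)"
    \<comment> \<open>\<open>A\<close> is a common factor of the three terms. The factor (k + 1)^2
      of the certificate cancels the denominator in \<open>q3\<close>, and clearing \<open>D\<close>
      leaves the polynomial identity \<open>poly\<close>.\<close>
    define A where "A = pochhammer b (k + Suc i) * pochhammer (1/2 - b) k * (- 1 / 4) ^ k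
      / (fact k * fact k * fact i)"
    have nz: "c + 1 \<noteq> 0" "x + 1 \<noteq> 0" "x + 2 \<noteq> 0"
      unfolding c_def x_def by (metis of_nat_Suc of_nat_eq_0_iff add.commute nat.distinct(1),
        metis of_nat_Suc of_nat_eq_0_iff add.commute nat.distinct(1),
        metis of_nat_add of_nat_numeral of_nat_eq_0_iff add_eq_0_iff_both_eq_0 zero_neq_numeral)
    have N: "N - k = k + Suc i" "Suc N - k = Suc (k + Suc i)" "Suc N - Suc k = k + Suc i"
      "N - 2 * k = Suc i" "Suc N - 2 * k = Suc (Suc i)" "Suc N - 2 * Suc k = i"
      using 4 by auto
    have f: "fact (Suc k) = (c + 1) * (fact k :: 'a)" "fact (Suc i) = (x + 1) * (fact i :: 'a)"
      "fact (Suc (Suc i)) = (x + 2) * ((x + 1) * (fact i :: 'a))"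
      by (simp_all add: c_def x_def algebra_simps)
    have p1: "pochhammer b (Suc (k + Suc i)) = pochhammer b (k + Suc i) * (b + c + x + 1)"
      unfolding pochhammer_Suc[of b "k + Suc i"] by (simp add: c_def x_def add_ac)
    have q1: "quad_term b N k = A / (x + 1)"
      using 4 nz by (simp add: quad_term_def N f A_def del: fact_Suc pochhammer_Suc)
    have q2: "quad_term b (Suc N) k = A * (b + c + x + 1) / ((x + 1) * (x + 2))"
      using 4 unfolding quad_term_def N f p1 A_def by (simp add: mult_ac)
    have q3: "quad_term b (Suc N) (Suc k) = A * (1/2 - b + c) * (- 1 / 4) / (c + 1)\<^sup>2"
      using 4 nz unfolding quad_term_def N f A_def
      by (simp add: pochhammer_Suc[of "1/2 - b" k] c_def x_def power2_eq_square mult_ac)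
    define y where "y = b + c + x + 1"
    define D where "D = (x + 1) * (x + 2)"
    have D: "D \<noteq> 0" "A / (x + 1) = A * (x + 2) / D" using nz by (simp_all add: D_def)
    have N': "of_nat N = 2 * c + x + 1" "of_nat (Suc k) = c + 1" using 4 by (simp_all add: c_def x_def)
    have poly: "(2 * c + x + 1 + 1)\<^sup>2 * (A * y)
        - (2 * b + (2 * c + x + 1)) * (2 * c + x + 1 + 1/2) * (A * (x + 2))
      = 4 * c\<^sup>2 * (A * y) + A * (1/2 - b + c) * D"
      unfolding y_def D_def by (simp add: power2_eq_square field_simps)
    have "(of_nat N + 1)\<^sup>2 * quad_term b (Suc N) k - (2 * b + of_nat N) * (of_nat N + 1/2) * quad_term b N k
      = ((2 * c + x + 1 + 1)\<^sup>2 * (A * y)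
        - (2 * b + (2 * c + x + 1)) * (2 * c + x + 1 + 1/2) * (A * (x + 2))) / D"
      unfolding q1 q2 N' D(2) by (simp add: diff_divide_distrib y_def D_def)
    also have "\<dots> = 4 * c\<^sup>2 * quad_term b (Suc N) k + A * (1/2 - b + c)"
      unfolding poly q2 using D(1) by (simp add: add_divide_distrib y_def D_def)
    also have "A * (1/2 - b + c) = - 4 * (of_nat (Suc k))\<^sup>2 * quad_term b (Suc N) (Suc k)"
      unfolding q3 N' using nz by simp
    finally show ?thesis by (simp add: c_def)
  qed
qed

text \<open>Summing the telescoping relation over k gives a first-order recurrence in N. The
  hypergeometric coefficients satisfy the same one, and both sides start at 1.\<close>

lemma quad_term_sum:
  fixes b :: "'a::field_char_0"
  assumes "N < L"
  shows "(\<Sum>k<L. quad_term b N k) = hyp_coeff (2 * b) (1/2) N"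
  using assms
proof (induction N)
  case 0
  then have "(\<Sum>k<L. quad_term b 0 k) = (\<Sum>k\<in>{0}. quad_term b 0 k)"
    by (intro sum.mono_neutral_right) (auto simp: quad_term_def)
  then show ?case by (simp add: quad_term_def hyp_coeff_def)
next
  case (Suc N)
  have "(of_nat N + 1)\<^sup>2 * (\<Sum>k<L. quad_term b (Suc N) k)
      - (2 * b + of_nat N) * (of_nat N + 1/2) * (\<Sum>k<L. quad_term b N k)
      = (\<Sum>k<L. 4 * (of_nat k)\<^sup>2 * quad_term b (Suc N) k - 4 * (of_nat (Suc k))\<^sup>2 * quad_term b (Suc N) (Suc k))"
    by (simp only: sum_distrib_left quad_term_telescope flip: sum_subtractf)
  \<comment> \<open>The boundary term at k = 0 vanishes by its factor k^2, the one at k = L because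
    2 * L > N + 1.\<close>
  also have "\<dots> = 0"
    using Suc.prems by (subst sum_lessThan_telescope') (simp add: quad_term_def)
  finally have "(of_nat N + 1)\<^sup>2 * (\<Sum>k<L. quad_term b (Suc N) k)
      = (2 * b + of_nat N) * (of_nat N + 1/2) * hyp_coeff (2 * b) (1/2) N"
    using Suc by simp
  moreover have "(of_nat N + 1 :: 'a) \<noteq> 0" by (metis of_nat_Suc of_nat_eq_0_iff add.commute nat.distinct(1))
  moreover have "hyp_coeff (2 * b) (1/2) (Suc N)
      = (2 * b + of_nat N) * (of_nat N + 1/2) * hyp_coeff (2 * b) (1/2) N / (of_nat N + 1)\<^sup>2"
    by (simp add: hyp_coeff_def pochhammer_Suc power2_eq_square mult_ac add_ac)
  ultimately show ?case
    by (metis mult.commute nonzero_mult_div_cancel_left power_not_zero)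
qed

text \<open>Coefficient form of 2F1(2b, 1/2; 1; X) = (1 - X)^(-b) 2F1(b, 1/2 - b; 1; X^2/(4X -
  4)).\<close>

lemma quadratic_transformation_coeff:
  fixes b :: "'a::field_char_0"
  assumes "N < L"
  shows "(\<Sum>k<L. fps_const (hyp_coeff b (1/2 - b) k * (- 1 / 4) ^ k) * fps_X ^ (2 * k) * fps_pow (b + of_nat k)) $ N
    = hyp_coeff (2 * b) (1/2) N"
proof -
  have "hyp_coeff b (1/2 - b) k * (- 1 / 4) ^ k * (pochhammer (b + of_nat k) (N - 2 * k) / fact (N - 2 * k))
      = quad_term b N k" if "2 * k \<le> N" for k
  proof -
    have "pochhammer b (N - k) = pochhammer b k * pochhammer (b + of_nat k) (N - k - k)"
      using that by (intro pochhammer_product) auto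
    moreover have "N - k - k = N - 2 * k" by simp
    ultimately show ?thesis using that by (simp add: hyp_coeff_def quad_term_def)
  qed
  then have "(\<Sum>k<L. fps_const (hyp_coeff b (1/2 - b) k * (- 1 / 4) ^ k) * fps_X ^ (2 * k) * fps_pow (b + of_nat k)) $ N
      = (\<Sum>k<L. quad_term b N k)"
    unfolding fps_sum_nth fps_const_X_power_mult_nth fps_pow_nth
    by (intro sum.cong) (auto simp: quad_term_def)
  then show ?thesis using quad_term_sum[OF assms] by simp
qed

section \<open>The congruence\<close>

lemma half_Zp:
  assumes "odd CARD('p::prime_card)"
  shows "(1/2 :: 'p padic) \<in> Zp"
proof -
  have "CARD('p) > 1" using prime_card prime_gt_1_nat by blast
  then have "\<not> CARD('p) dvd 2" using assms by (auto dest: dvd_imp_le simp: le_Suc_eq numeral_2_eq_2)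
  then show ?thesis
    using inverse_of_nat_Zp[where 'p = 'p, of 2] by (simp add: inverse_eq_divide)
qed

lemma hyp_coeff_padic_ideal:
  fixes a b :: "'p::prime_card padic"
  assumes "pochhammer a k \<in> padic_ideal r" "pochhammer b k \<in> padic_ideal s" "k < CARD('p)"
  shows "hyp_coeff a b k \<in> padic_ideal (r + s)"
  using padic_ideal_mult[OF assms(1,2)] inverse_fact_Zp[OF assms(3)]
  by (auto simp: hyp_coeff_def divide_inverse intro!: padic_ideal_mult_right Zp_mult)

text \<open>Each Pochhammer symbol has a factor divisible by p, and k < p keeps p out of the
  denominator.\<close>

lemma hyp_coeff_padic_ideal_2:
  fixes a b :: "'p::prime_card padic"
  assumes "a \<in> Zp" "b \<in> Zp" "a + of_nat i \<in> padic_ideal 1" "b + of_nat j \<in> padic_ideal 1"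
    and "i < k" "j < k" "k < CARD('p)"
  shows "hyp_coeff a b k \<in> padic_ideal 2"
  using hyp_coeff_padic_ideal[of a k 1 b 1] pochhammer_padic_ideal[OF assms(1,3,5)]
    pochhammer_padic_ideal[OF assms(2,4,6)] assms(7) by (simp add: numeral_2_eq_2)

text \<open>Coefficients from degree p on are left free, since factorials may bring p into their
  denominators. Products stay under control because the coefficient of X^n in a product involves
  only degrees up to n.\<close>

definition fps_ideal :: "nat \<Rightarrow> 'p::prime_card padic fps set" where
  "fps_ideal r = {F. \<forall>n<CARD('p). F $ n \<in> padic_ideal r}"

lemma fps_ideal_mult: "F \<in> fps_ideal r \<Longrightarrow> G \<in> fps_ideal s \<Longrightarrow> F * G \<in> fps_ideal (r + s)"
  by (auto simp: fps_ideal_def fps_mult_nth intro!: padic_ideal_sum padic_ideal_mult)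

lemma fps_ideal_mult_left: "F \<in> fps_ideal 0 \<Longrightarrow> G \<in> fps_ideal r \<Longrightarrow> F * G \<in> fps_ideal r"
  using fps_ideal_mult[of F 0 G r] by simp

lemma fps_ideal_add: "F \<in> fps_ideal r \<Longrightarrow> G \<in> fps_ideal r \<Longrightarrow> F + G \<in> fps_ideal r"
  by (auto simp: fps_ideal_def intro: padic_ideal_add)

lemma fps_ideal_diff: "F \<in> fps_ideal r \<Longrightarrow> G \<in> fps_ideal r \<Longrightarrow> F - G \<in> fps_ideal r"
  by (auto simp: fps_ideal_def intro: padic_ideal_diff)

lemma fps_ideal_sum: "(\<And>i. i \<in> S \<Longrightarrow> f i \<in> fps_ideal r) \<Longrightarrow> sum f S \<in> fps_ideal r"
  by (auto simp: fps_ideal_def fps_sum_nth intro!: padic_ideal_sum)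

lemma fps_pow_fps_ideal: "b \<in> Zp \<Longrightarrow> fps_pow b \<in> fps_ideal 0"
  using inverse_fact_Zp
  by (auto simp: fps_ideal_def fps_pow_nth padic_ideal_0 divide_inverse intro!: Zp_mult pochhammer_Zp)

text \<open>The constant terms cancel, and for n > 0 the symbol (b)_n contains the factor b,
  divisible by p.\<close>

lemma one_minus_fps_pow_fps_ideal:
  fixes b :: "'p::prime_card padic"
  assumes "b \<in> Zp" "b \<in> padic_ideal 1"
  shows "1 - fps_pow b \<in> fps_ideal 1"
  unfolding fps_ideal_def
proof safe
  fix n assume n: "n < CARD('p)"
  show "(1 - fps_pow b) $ n \<in> padic_ideal 1"
  proof (cases "n = 0")
    case False
    then have "pochhammer b n * inverse (fact n) \<in> padic_ideal 1"
      using pochhammer_padic_ideal[of b 0 1 n] inverse_fact_Zp[OF n] assms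
      by (intro padic_ideal_mult_right) auto
    with False show ?thesis
      using padic_ideal_uminus by (fastforce simp: fps_pow_nth divide_inverse)
  qed (simp add: fps_pow_nth padic_ideal_zero)
qed

lemma fps_const_X_power_mult_fps_ideal:
  "c \<in> padic_ideal r \<Longrightarrow> F \<in> fps_ideal 0 \<Longrightarrow> fps_const c * fps_X ^ k * F \<in> fps_ideal r"
  by (auto simp: fps_ideal_def fps_const_X_power_mult_nth padic_ideal_0
      intro: padic_ideal_mult_right padic_ideal_zero)

text \<open>A polynomial of degree below p has no coefficient hidden from
  \<open>fps_ideal\<close>.\<close>

lemma poly_padic_ideal:
  fixes Q :: "'p::prime_card padic poly"
  assumes "fps_of_poly Q \<in> fps_ideal r" "degree Q < CARD('p)" "z \<in> Zp"
  shows "poly Q z \<in> padic_ideal r"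
  unfolding poly_altdef using assms
  by (intro padic_ideal_sum padic_ideal_mult_right Zp_power) (auto simp: fps_ideal_def)

section \<open>The truncated identity as a polynomial of degree below p\<close>

text \<open>
  In the theorem \<open>2 * \<beta> = \<alpha>\<close> and \<open>s = max 0 ((p - 1) / 2 - a)\<close>. The factor \<open>(1 - z) ^ s\<close> clears the
  denominators \<open>z - 1\<close> of the two transformed arguments, leaving a polynomial of degree at most \<open>2 * M\<close>.
\<close>

lemma truncated_sums_padic_ideal:
  fixes \<beta> e z :: "'p::prime_card padic"
  assumes odd: "odd CARD('p)" and z: "z \<in> Zp" and \<beta>: "\<beta> = e - of_nat m"
    and e: "e \<in> Zp" "e \<in> padic_ideal 1"
    and N: "N = 2 * m + s" and M: "M = m + s" and MN: "2 * M < CARD('p)"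
    and f: "\<And>k. N < k \<Longrightarrow> k < CARD('p) \<Longrightarrow> hyp_coeff (2 * \<beta>) (1/2) k \<in> padic_ideal 2"
    and g: "\<And>k. M < k \<Longrightarrow> k < CARD('p) \<Longrightarrow> hyp_coeff \<beta> (1/2 - \<beta>) k \<in> padic_ideal 2"
  shows "(1 - z) ^ s * (\<Sum>k\<le>N. hyp_coeff (2 * \<beta>) (1/2) k * z ^ k)
    + (\<Sum>k\<le>N. hyp_coeff (2 * \<beta>) (1/2) k * (- 1) ^ k * (z ^ k * (1 - z) ^ (N - k)))
    - 2 * (\<Sum>k\<le>M. hyp_coeff \<beta> (1/2 - \<beta>) k * (- 1 / 4) ^ k * (z ^ (2 * k) * (1 - z) ^ (M - k)))
    \<in> padic_ideal 2"
proof -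
  let ?p = "CARD('p)"
  define f' where "f' = hyp_coeff (2 * \<beta>) (1/2)"
  define g' where "g' = hyp_coeff \<beta> (1/2 - \<beta>)"
  define Q where "Q = [:1, -1:] ^ s * (\<Sum>k\<le>N. Polynomial.monom (f' k) k)
    + (\<Sum>k\<le>N. Polynomial.monom (f' k * (- 1) ^ k) k * [:1, -1:] ^ (N - k))
    - Polynomial.smult 2 (\<Sum>k\<le>M. Polynomial.monom (g' k * (- 1 / 4) ^ k) (2 * k) * [:1, -1:] ^ (M - k))"
  \<comment> \<open>\<open>A0\<close>, \<open>A1\<close>, \<open>A2\<close> are sums over an index
    set of terms of the original series, its Pfaff expansion and its quadratic expansion.
    \<open>D0\<close>, \<open>D1\<close>, \<open>D2\<close> are the errors made when their initial
    parts replace \<open>A0 {..<?p}\<close>.\<close>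
  define A0 where "A0 = (\<lambda>K. \<Sum>k\<in>K. fps_const (f' k) * fps_X ^ k)"
  define A1 where "A1 = (\<lambda>K. \<Sum>k\<in>K. fps_const (f' k * (- 1) ^ k) * fps_X ^ k * fps_pow (2 * \<beta> + of_nat k))"
  define A2 where "A2 = (\<lambda>K. \<Sum>k\<in>K. fps_const (g' k * (- 1 / 4) ^ k) * fps_X ^ (2 * k) * fps_pow (\<beta> + of_nat k))"
  define D0 D1 D2 where "D0 = A0 {..<?p} - A0 {..N}" and "D1 = A0 {..<?p} - A1 {..N}"
    and "D2 = A0 {..<?p} - A2 {..M}"
  \<comment> \<open>As \<open>fps_pow b\<close> is (1 - X)^(-b), \<open>P\<close> is (1 - X)^e and
    \<open>S\<close> is (1 - X)^s.\<close>
  define P where "P = fps_pow (- e)"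
  define S where "S = fps_pow (- (of_nat s :: 'p padic))"
  have NM: "N \<le> 2 * M" "N < ?p" "M < ?p" using N M MN by auto
  have Z\<beta>: "\<beta> \<in> Zp" unfolding \<beta> by (intro Zp_diff e Zp_of_nat)
  have Z2\<beta>: "2 * \<beta> \<in> Zp" unfolding mult_2 by (intro Zp_add Z\<beta>)
  have Zh: "1/2 - \<beta> \<in> Zp" by (intro Zp_diff half_Zp odd Z\<beta>)
  have Zq: "(- 1 / 4) ^ k \<in> (Zp :: 'p padic set)" for k
  proof -
    have "- (1/2 * (1/2)) \<in> (Zp :: 'p padic set)" by (intro Zp_uminus Zp_mult half_Zp odd)
    then show ?thesis by (intro Zp_power) simp
  qed
  have Zs: "(- 1) ^ k \<in> (Zp :: 'p padic set)" for k by (intro Zp_power Zp_uminus Zp_1)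
  have Zf: "f' k \<in> Zp" if "k < ?p" for k
    using hyp_coeff_padic_ideal[of "2 * \<beta>" k 0 "1/2" 0] that
    by (simp add: padic_ideal_0 pochhammer_Zp Z2\<beta> half_Zp odd f'_def)
  have sum_split: "sum h {..<?p} = sum h {..K} + sum h {K<..<?p}" if "K < ?p"
    for h :: "nat \<Rightarrow> 'p padic fps" and K
  proof -
    have eq: "{..<?p} = {..K} \<union> {K<..<?p}" using that by auto
    show ?thesis unfolding eq by (rule sum.union_disjoint) auto
  qed
  have A_split: "A0 {..<?p} = A0 {..N} + A0 {N<..<?p}" "A1 {..<?p} = A1 {..N} + A1 {N<..<?p}"
    "A2 {..<?p} = A2 {..M} + A2 {M<..<?p}"
    unfolding A0_def A1_def A2_def by (rule sum_split; rule NM)+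
  have A0_nth: "A0 {..<?p} $ n = (if n < ?p then f' n else 0)" for n
  proof -
    have "(fps_const (f' k) * fps_X ^ k) $ n = (if n = k then f' k else 0)" for k by simp
    then show ?thesis by (simp only: A0_def fps_sum_nth) (simp add: sum.delta')
  qed
  have A0: "A0 {..<?p} \<in> fps_ideal 0"
    using Zf by (auto simp: fps_ideal_def A0_nth padic_ideal_0)
  have tails: "A0 {N<..<?p} \<in> fps_ideal 2" "A1 {N<..<?p} \<in> fps_ideal 2" "A2 {M<..<?p} \<in> fps_ideal 2"
  proof -
    have 1: "fps_const (f' k) * fps_X ^ k * fps_pow 0 \<in> fps_ideal 2" if "k \<in> {N<..<?p}" for k
      using that f by (intro fps_const_X_power_mult_fps_ideal fps_pow_fps_ideal Zp_0) (auto simp: f'_def)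
    then show "A0 {N<..<?p} \<in> fps_ideal 2"
      unfolding A0_def by (intro fps_ideal_sum) (simp add: fps_pow_0)
    show "A1 {N<..<?p} \<in> fps_ideal 2"
      unfolding A1_def using f
      by (intro fps_ideal_sum fps_const_X_power_mult_fps_ideal fps_pow_fps_ideal Zp_add Z2\<beta> Zp_of_nat
          padic_ideal_mult_right Zs) (auto simp: f'_def)
    show "A2 {M<..<?p} \<in> fps_ideal 2"
      unfolding A2_def using g
      by (intro fps_ideal_sum fps_const_X_power_mult_fps_ideal fps_pow_fps_ideal Zp_add Z\<beta> Zp_of_nat
          padic_ideal_mult_right Zq) (auto simp: g'_def)
  qed
  have D0: "D0 \<in> fps_ideal 2" using tails(1) by (simp add: D0_def A_split)
  \<comment> \<open>Below degree p both formal transformations hold exactly with summation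
    restricted to k < p.\<close>
  have "A0 {..<?p} $ n = A1 {..<?p} $ n" "A0 {..<?p} $ n = A2 {..<?p} $ n" if "n < ?p" for n
    using that pfaff_half_coeff[of n ?p "2 * \<beta>"] quadratic_transformation_coeff[of n ?p \<beta>]
    by (simp_all add: A0_nth A1_def A2_def f'_def g'_def)
  then have "A0 {..<?p} - A1 {..<?p} \<in> fps_ideal 2" "A0 {..<?p} - A2 {..<?p} \<in> fps_ideal 2"
    by (auto simp: fps_ideal_def padic_ideal_zero)
  then have D12: "D1 \<in> fps_ideal 2" "D2 \<in> fps_ideal 2"
    using fps_ideal_add[OF _ tails(2)] fps_ideal_add[OF _ tails(3)]
    by (force simp: D1_def D2_def A_split(2,3))+
  have "[:1, -1:] = (1 - [:0, 1:] :: 'p padic poly)" by (simp add: one_pCons)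
  then have lin: "fps_of_poly [:1, -1 :: 'p padic:] = 1 - fps_X"
    by (simp only: fps_of_poly_diff fps_of_poly_1 fps_of_poly_fps_X)
  have mon: "fps_of_poly (Polynomial.monom c k) = fps_const c * fps_X ^ k" for c :: "'p padic" and k
    by (rule fps_of_poly_monom)
  have q0: "fps_of_poly ([:1, -1:] ^ s * (\<Sum>k\<le>N. Polynomial.monom (f' k) k)) = S * A0 {..N}"
    by (simp add: fps_of_poly_mult fps_of_poly_power fps_of_poly_sum lin mon S_def A0_def
        fps_pow_minus_of_nat)
  \<comment> \<open>Since \<open>\<beta> = e - of_nat m\<close>, the p-adic exponents add up to an
    integer: s + 2e - 2\<beta> - k = N - k.\<close>
  have q1': "S * (P * P) * fps_pow (2 * \<beta> + of_nat k) = (1 - fps_X) ^ (N - k)" if "k \<le> N" for k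
  proof -
    have eq: "- of_nat s + (- e + - e) + (2 * \<beta> + of_nat k) = - of_nat (N - k)"
      using that by (simp add: of_nat_diff N \<beta>)
    have "S * (P * P) * fps_pow (2 * \<beta> + of_nat k) = fps_pow (- of_nat s + (- e + - e) + (2 * \<beta> + of_nat k))"
      by (simp only: S_def P_def fps_pow_add)
    then show ?thesis by (simp only: eq fps_pow_minus_of_nat)
  qed
  have q1: "fps_of_poly (\<Sum>k\<le>N. Polynomial.monom (f' k * (- 1) ^ k) k * [:1, -1:] ^ (N - k))
      = S * (P * P) * A1 {..N}"
    unfolding A1_def fps_of_poly_sum sum_distrib_left fps_of_poly_mult fps_of_poly_power lin mon
    by (intro sum.cong refl) (simp add: q1'[symmetric] mult_ac)
  \<comment> \<open>Here a single \<open>P\<close> is needed: s + e - \<beta> - k = M - k.\<close>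
  have q2': "S * P * fps_pow (\<beta> + of_nat k) = (1 - fps_X) ^ (M - k)" if "k \<le> M" for k
  proof -
    have eq: "- of_nat s + - e + (\<beta> + of_nat k) = - of_nat (M - k)"
      using that by (simp add: of_nat_diff M \<beta>)
    have "S * P * fps_pow (\<beta> + of_nat k) = fps_pow (- of_nat s + - e + (\<beta> + of_nat k))"
      by (simp only: S_def P_def fps_pow_add)
    then show ?thesis by (simp only: eq fps_pow_minus_of_nat)
  qed
  have q2: "fps_of_poly (\<Sum>k\<le>M. Polynomial.monom (g' k * (- 1 / 4) ^ k) (2 * k) * [:1, -1:] ^ (M - k))
      = S * P * A2 {..M}"
    unfolding A2_def fps_of_poly_sum sum_distrib_left fps_of_poly_mult fps_of_poly_power lin mon
    by (intro sum.cong refl) (simp add: q2'[symmetric] mult_ac)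
  have "fps_of_poly Q = S * A0 {..N} + S * (P * P) * A1 {..N} - fps_const 2 * (S * P * A2 {..M})"
    unfolding Q_def fps_of_poly_diff fps_of_poly_add fps_of_poly_smult q0 q1 q2 ..
  also have "fps_const (2 :: 'p padic) = 2" by (rule fps_numeral_fps_const[symmetric])
  \<comment> \<open>After each initial part is written as \<open>A0 {..<?p}\<close> minus its error,
    the multipliers 1, P^2 and -2P combine to (1 - P)^2. Each factor 1 - P contributes one p; the
    errors are already divisible by p^2.\<close>
  also have "S * A0 {..N} + S * (P * P) * A1 {..N} - 2 * (S * P * A2 {..M})
      = S * ((1 - P) * (1 - P) * A0 {..<?p} - D0 - P * (P * D1) + (P * D2 + P * D2))"
    by (simp add: D0_def D1_def D2_def algebra_simps)
  also have "\<dots> \<in> fps_ideal 2"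
  proof -
    have "P \<in> fps_ideal 0" "S \<in> fps_ideal 0"
      unfolding P_def S_def by (intro fps_pow_fps_ideal Zp_uminus e Zp_of_nat)+
    moreover have "(1 - P) * (1 - P) * A0 {..<?p} \<in> fps_ideal (1 + 1 + 0)"
      unfolding P_def
      by (intro fps_ideal_mult one_minus_fps_pow_fps_ideal A0 Zp_uminus padic_ideal_uminus e)
    ultimately show ?thesis
      by (intro fps_ideal_mult_left[of S] fps_ideal_add fps_ideal_diff fps_ideal_mult_left[of P] D0 D12)
        (simp_all add: numeral_2_eq_2)
  qed
  finally have "fps_of_poly Q \<in> fps_ideal 2" .
  \<comment> \<open>The three parts have degrees at most s + N = 2M, N, and 2k + (M - k) with k
    \<le> M.\<close>
  moreover have "degree Q \<le> 2 * M"
  proof -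
    have lp: "degree ([:1, -1 :: 'p padic:] ^ k) \<le> k" for k
      using degree_power_le[of "[:1, -1 :: 'p padic:]" k] by simp
    have mp: "degree (Polynomial.monom c j * [:1, -1 :: 'p padic:] ^ k) \<le> 2 * M" if "j + k \<le> 2 * M" for c j k
      using degree_mult_le[of "Polynomial.monom c j" "[:1, -1:] ^ k"] degree_monom_le[of c j] lp[of k] that by linarith
    have "degree (\<Sum>k\<le>N. Polynomial.monom (f' k) k) \<le> N"
      by (intro degree_sum_le) (auto intro: order_trans[OF degree_monom_le])
    then have "degree ([:1, -1:] ^ s * (\<Sum>k\<le>N. Polynomial.monom (f' k) k)) \<le> 2 * M"
      using degree_mult_le[of "[:1, -1:] ^ s" "\<Sum>k\<le>N. Polynomial.monom (f' k) k"] lp[of s] N M by linarith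
    then show ?thesis
      unfolding Q_def using NM(1)
      by (intro degree_diff_le degree_add_le order_trans[OF degree_smult_le] degree_sum_le mp) auto
  qed
  ultimately have "poly Q z \<in> padic_ideal 2"
    using poly_padic_ideal[OF _ _ z] MN by auto
  then show ?thesis
    by (simp add: Q_def poly_sum poly_monom f'_def g'_def mult.assoc sum_distrib_left)
qed

section \<open>From the short sums to truncation at p - 1\<close>

lemma sum_trunc_padic_ideal:
  fixes c :: "nat \<Rightarrow> 'p::prime_card padic"
  assumes "\<And>k. N < k \<Longrightarrow> k < CARD('p) \<Longrightarrow> c k \<in> padic_ideal r" "N < CARD('p)" "x \<in> Zp"
  shows "(\<Sum>k\<le>CARD('p) - 1. c k * x ^ k) - (\<Sum>k\<le>N. c k * x ^ k) \<in> padic_ideal r"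
proof -
  have "{..CARD('p) - 1} = {..N} \<union> {N<..<CARD('p)}" using assms(2) by auto
  then have "(\<Sum>k\<le>CARD('p) - 1. c k * x ^ k) - (\<Sum>k\<le>N. c k * x ^ k) = (\<Sum>k\<in>{N<..<CARD('p)}. c k * x ^ k)"
    by (simp add: sum.union_disjoint ivl_disj_int)
  also have "\<dots> \<in> padic_ideal r"
    using assms by (intro padic_ideal_sum padic_ideal_mult_right Zp_power) auto
  finally show ?thesis .
qed

theorem theorem2p8:
  fixes p :: nat and \<alpha> z :: "'p::prime_card padic"
  assumes "p = CARD('p)" and "prime p" and "odd p"
    and "\<alpha> \<in> Zp" and "z \<in> Zp"
    and "even (padic_residue (- \<alpha>))"
    and "prime_to_p (z - 1)"
  shows "padic_cong 2
    (hyp2F1_trunc \<alpha> (1/2) 1 z (p - 1)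
      + (1 - z) ^ padic_residue (- \<alpha>) * hyp2F1_trunc \<alpha> (1/2) 1 (z / (z - 1)) (p - 1))
    (2 * (1 - z) ^ (padic_residue (- \<alpha>) div 2)
      * hyp2F1_trunc (\<alpha> / 2) (1/2 - \<alpha> / 2) 1 (z^2 / (4 * z - 4)) (p - 1))"
proof -
  let ?p = "CARD('p)"
  have odd: "odd ?p" using assms(1,3) by simp
  have res: "padic_residue (- \<alpha>) < ?p \<and> padic_cong 1 (- \<alpha>) (of_nat (padic_residue (- \<alpha>)))"
    unfolding padic_residue_def by (rule theI') (intro padic_residue_ex1 Zp_uminus assms)
  obtain m where m: "padic_residue (- \<alpha>) = 2 * m" using assms(6) by blast
  obtain n where n: "?p = 2 * n + 1" using odd by (rule oddE)
  have mn: "m \<le> n" using res m n by simp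
  define \<beta> e where "\<beta> = \<alpha> / 2" and "e = \<alpha> / 2 + of_nat m"
  \<comment> \<open>By truncated subtraction \<open>N\<close> = max(2m, n) and \<open>M\<close> =
    max(m, n - m), where n = (p - 1)/2.\<close>
  define s where "s = n - 2 * m"
  define N M where "N = 2 * m + s" and "M = m + s"
  define u where "u = 1 - z"
  have h: "1/2 \<in> (Zp :: 'p padic set)" by (rule half_Zp[OF odd])
  have e2: "e = - (1/2) * (- \<alpha> - of_nat (2 * m))" by (simp add: e_def field_simps)
  have e: "e \<in> padic_ideal 1"
    using res unfolding m padic_cong_iff e2 by (intro padic_ideal_mult_left Zp_uminus h) simp
  have Z: "\<alpha> \<in> Zp" "\<beta> \<in> Zp" "e \<in> Zp" "1/2 - \<beta> \<in> Zp"
  proof -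
    show "\<alpha> \<in> Zp" by fact
    then show "\<beta> \<in> Zp" using Zp_mult[OF h, of \<alpha>] by (simp add: \<beta>_def)
    then show "e \<in> Zp" "1/2 - \<beta> \<in> Zp"
      using h Zp_add[OF _ Zp_of_nat] Zp_diff by (auto simp: \<beta>_def e_def)
  qed
  have \<beta>: "\<beta> = e - of_nat m" "\<alpha> = 2 * \<beta>" by (simp_all add: e_def \<beta>_def)
  have half_p: "of_nat ?p * (1/2) \<in> (padic_ideal 1 :: 'p padic set)"
    by (intro padic_ideal_mult_right of_nat_CARD_padic_ideal h)
  \<comment> \<open>Once k > N, both Pochhammer symbols have met a multiple of p: \<alpha> + 2m = 2e
    and 1/2 + n = p/2.\<close>
  have f: "hyp_coeff \<alpha> (1/2) k \<in> padic_ideal 2" if "N < k" "k < ?p" for k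
  proof (rule hyp_coeff_padic_ideal_2[of _ _ "2 * m" n])
    show "\<alpha> + of_nat (2 * m) \<in> padic_ideal 1"
      using padic_ideal_add[OF e e] by (simp add: e_def algebra_simps)
    show "1/2 + of_nat n \<in> (padic_ideal 1 :: 'p padic set)"
      using half_p by (simp add: n add_divide_distrib add.commute)
    show "n < k" "2 * m < k" using that by (auto simp: N_def s_def)
  qed (use that Z h in auto)
  \<comment> \<open>Here the multiples of p are \<beta> + m = e and 1/2 - \<beta> + (n - m) = p/2 -
    e.\<close>
  have g: "hyp_coeff \<beta> (1/2 - \<beta>) k \<in> padic_ideal 2" if "M < k" "k < ?p" for k
  proof (rule hyp_coeff_padic_ideal_2[of _ _ m "n - m"])
    show "\<beta> + of_nat m \<in> padic_ideal 1" using e by (simp add: e_def \<beta>_def)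
    have "1/2 - \<beta> + of_nat (n - m) = of_nat ?p * (1/2) - e"
      using mn by (simp add: n \<beta>(1) of_nat_diff add_divide_distrib)
    then show "1/2 - \<beta> + of_nat (n - m) \<in> padic_ideal 1"
      using padic_ideal_diff[OF half_p e] by simp
    show "m < k" "n - m < k" using that by (auto simp: M_def s_def)
  qed (use that Z in auto)
  have NM: "2 * M < ?p" "N < ?p" "M < ?p" using mn res m n by (auto simp: M_def N_def s_def)
  have iu: "inverse u \<in> Zp"
    using Zp_uminus[OF prime_to_p_imp_inverse_Zp[OF assms(7)]]
    by (metis u_def inverse_minus_eq minus_diff_eq)
  have u0: "u \<noteq> 0" using assms(7) Zp_0 by (force simp: prime_to_p_def u_def)
  have Zu: "u \<in> Zp" unfolding u_def by (intro Zp_diff Zp_1 assms)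
  define y w where "y = z / (z - 1)" and "w = z\<^sup>2 / (4 * z - 4)"
  \<comment> \<open>With -1 and -1/4 split off, powers of \<open>y\<close> and \<open>w\<close>
    match the terms of the polynomial identity once \<open>u ^ (N - k)\<close> and
    \<open>u ^ (M - k)\<close> are factored.\<close>
  have y: "y = - 1 * (z * inverse u)"
    using u0 by (simp add: y_def u_def field_simps)
  have w: "w = (- 1 / 4) * (z\<^sup>2 * inverse u)"
    using u0 by (simp add: w_def u_def field_simps)
  have Zy: "y \<in> Zp" unfolding y by (intro Zp_mult Zp_uminus Zp_1 assms iu)
  have "- (1/2 * (1/2)) * (z\<^sup>2 * inverse u) \<in> Zp"
    by (intro Zp_mult Zp_uminus h Zp_power assms iu)
  then have Zw: "w \<in> Zp" by (simp add: w)
  define F G where "F = hyp_coeff \<alpha> (1/2)" and "G = hyp_coeff \<beta> (1/2 - \<beta>)"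
  define F\<^sub>N where "F\<^sub>N = (\<lambda>x. \<Sum>k\<le>N. F k * x ^ k)"
  define G\<^sub>M where "G\<^sub>M = (\<lambda>x. \<Sum>k\<le>M. G k * x ^ k)"
  have "u ^ s * F\<^sub>N z + (\<Sum>k\<le>N. F k * (- 1) ^ k * (z ^ k * u ^ (N - k)))
      - 2 * (\<Sum>k\<le>M. G k * (- 1 / 4) ^ k * (z ^ (2 * k) * u ^ (M - k))) \<in> padic_ideal 2"
    using truncated_sums_padic_ideal[OF odd assms(5) \<beta>(1) Z(3) e N_def M_def NM(1)] f g \<beta>(2)
    by (simp add: F_def G_def F\<^sub>N_def u_def)
  moreover have "(\<Sum>k\<le>N. F k * (- 1) ^ k * (z ^ k * u ^ (N - k))) = u ^ s * (u ^ (2 * m) * F\<^sub>N y)"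
  proof -
    have "u ^ (N - k) = u ^ N * inverse u ^ k" if "k \<le> N" for k
      using that u0 by (simp add: power_diff power_inverse divide_inverse)
    then show ?thesis
      unfolding F\<^sub>N_def sum_distrib_left y power_mult_distrib
      by (intro sum.cong) (simp_all add: N_def power_add mult_ac)
  qed
  moreover have "(\<Sum>k\<le>M. G k * (- 1 / 4) ^ k * (z ^ (2 * k) * u ^ (M - k))) = u ^ s * (u ^ m * G\<^sub>M w)"
  proof -
    have "u ^ (M - k) = u ^ M * inverse u ^ k" if "k \<le> M" for k
      using that u0 by (simp add: power_diff power_inverse divide_inverse)
    then show ?thesis
      unfolding G\<^sub>M_def sum_distrib_left w power_mult_distrib power_mult
      by (intro sum.cong) (simp_all add: M_def power_add mult_ac)
  qed
  ultimately have "u ^ s * (F\<^sub>N z + u ^ (2 * m) * F\<^sub>N y - 2 * (u ^ m * G\<^sub>M w)) \<in> padic_ideal 2"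
    by (simp add: algebra_simps)
  \<comment> \<open>As u = 1 - z is a unit, the auxiliary factor u^s cancels without loss of a power
    of p.\<close>
  from padic_ideal_mult_left[OF Zp_power[OF iu, of s] this]
  have trunc: "F\<^sub>N z + u ^ (2 * m) * F\<^sub>N y - 2 * (u ^ m * G\<^sub>M w) \<in> padic_ideal 2"
    using u0 by (simp add: power_inverse mult.assoc[symmetric])
  define F\<^sub>p where "F\<^sub>p = (\<lambda>x. hyp2F1_trunc \<alpha> (1/2) 1 x (?p - 1))"
  define G\<^sub>p where "G\<^sub>p = (\<lambda>x. hyp2F1_trunc \<beta> (1/2 - \<beta>) 1 x (?p - 1))"
  have dF: "F\<^sub>p x - F\<^sub>N x \<in> padic_ideal 2" if "x \<in> Zp" for x
    unfolding F\<^sub>p_def F\<^sub>N_def hyp2F1_trunc_1 F_def using f NM that by (intro sum_trunc_padic_ideal) auto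
  have dG: "G\<^sub>p x - G\<^sub>M x \<in> padic_ideal 2" if "x \<in> Zp" for x
    unfolding G\<^sub>p_def G\<^sub>M_def hyp2F1_trunc_1 G_def using g NM that by (intro sum_trunc_padic_ideal) auto
  \<comment> \<open>Passing from the short sums to the sums up to p - 1 changes the expression only
    by multiples of p^2.\<close>
  have "(F\<^sub>N z + u ^ (2 * m) * F\<^sub>N y - 2 * (u ^ m * G\<^sub>M w)) + (F\<^sub>p z - F\<^sub>N z)
      + u ^ (2 * m) * (F\<^sub>p y - F\<^sub>N y) - (of_nat 2 * u ^ m) * (G\<^sub>p w - G\<^sub>M w) \<in> padic_ideal 2"
    by (intro padic_ideal_add padic_ideal_diff trunc padic_ideal_mult_left dF dG Zp_mult Zp_power Zu
        Zp_of_nat Zy Zw assms(5))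
  then have "F\<^sub>p z + u ^ (2 * m) * F\<^sub>p y - 2 * u ^ m * G\<^sub>p w \<in> padic_ideal 2"
    by (simp add: algebra_simps)
  then show ?thesis
    unfolding padic_cong_iff m F\<^sub>p_def G\<^sub>p_def u_def y_def w_def \<beta>_def assms(1) by simp
qed

end
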